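(* Let $X_\gamma$ be a homogeneous Poisson point process of intensity $\gamma$ in $\mathbb{R}^d$ and let $W\subset\mathbb{R}^d$ be a convex body with $\lambda_d(W)=1$. Assume that there exists $\alpha>0$ such that, for $v$ small enough and for all $y\in W$, \[\lambda_d(B(y,v)\cap W)\geq\alpha\,\lambda_d(B(y,v)).\] Then \[\mathbb{P}\left(d_H(W,\mathscr{V}_{X_\gamma}(W))\leq\left(c(\alpha)\gamma^{-1}\log\left(\alpha_1\gamma(\log\gamma)^{d-1}\right)\right)^{1/d}\right)\underset{\gamma\to\infty}{\longrightarrow}1,\] where $c(\alpha)=\kappa_d^{-1}+2^d\kappa_d^{-1}\alpha^{-1}$.
   Context: $\lambda_d$ is Lebesgue measure on $\mathbb{R}^d$, $B(x,r)$ is the ball of radius $r$ centered at $x$, $\kappa_d=\lambda_d(B(0,1))$, and $d_H$ is the Hausdorff distance. A convex body is a convex compact set with non-empty interior. For a locally finite set $\chi\subset\mathbb{R}^d$ and $x\in\chi$, the Voronoi cell of nucleus $x$ is $C_\chi(x)=\{y\in\mathbb{R}^d: |y-x|\leq|y-x'| \text{ for all } x'\in\chi,\ x'\neq x\}$. The Poisson-Voronoi approximation of $W$ is \[\mathscr{V}_{X_\gamma}(W)=\bigcup_{x\in X_\gamma\cap W}C_{X_\gamma}(x).\] The constant $\alpha_1$ is \[\alpha_1=\frac{1}{d!}\left(\frac{\pi^{1/2}\,\Gamma\left(\frac d2+1\right)}{\Gamma\left(\frac{d+1}{2}\right)}\right)^{d-1}.\] *)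

theory Defs
  imports "HOL-Probability.Probability"
begin

definition locally_finite_set :: "'a::metric_space set \<Rightarrow> bool" where
  "locally_finite_set S \<longleftrightarrow> (\<forall>B. bounded B \<longrightarrow> finite (S \<inter> B))"

text \<open>
  The process is a random locally finite set, given through its counting variables on
  bounded Borel sets. The Poisson weights are written out, because the library facts on
  \<open>poisson_pmf\<close> exclude rate 0, which occurs here for null sets.
\<close>

locale homogeneous_poisson_process = prob_space M
  for M :: "'w measure" and X :: "'w \<Rightarrow> 'a::euclidean_space set" and \<gamma> :: real +
  assumes intensity_pos: "0 < \<gamma>"
    and locally_finite: "\<And>\<omega>. \<omega> \<in> space M \<Longrightarrow> locally_finite_set (X \<omega>)"
    and count_random_variable:
      "\<And>B. B \<in> sets borel \<Longrightarrow> bounded B \<Longrightarrow>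
        random_variable (count_space UNIV) (\<lambda>\<omega>. card (X \<omega> \<inter> B))"
    and count_poisson:
      "\<And>B k. B \<in> sets borel \<Longrightarrow> bounded B \<Longrightarrow>
        prob {\<omega> \<in> space M. card (X \<omega> \<inter> B) = k} =
          (\<gamma> * measure lborel B) ^ k / fact k * exp (- (\<gamma> * measure lborel B))"
    and count_independent:
      "\<And>(I :: nat set) B. finite I \<Longrightarrow> (\<forall>i\<in>I. B i \<in> sets borel \<and> bounded (B i)) \<Longrightarrow>
        disjoint_family_on B I \<Longrightarrow>
        indep_vars (\<lambda>_. count_space UNIV) (\<lambda>i \<omega>. card (X \<omega> \<inter> B i)) I"

definition convex_body :: "'a::euclidean_space set \<Rightarrow> bool" where
  "convex_body W \<longleftrightarrow> convex W \<and> compact W \<and> interior W \<noteq> {}"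

definition voronoi_cell :: "'a::euclidean_space set \<Rightarrow> 'a \<Rightarrow> 'a set" where
  "voronoi_cell S x = {y. \<forall>x'\<in>S. x' \<noteq> x \<longrightarrow> norm (y - x) \<le> norm (y - x')}"

definition voronoi_approximation :: "'a::euclidean_space set \<Rightarrow> 'a set \<Rightarrow> 'a set" where
  "voronoi_approximation S W = (\<Union>x\<in>S \<inter> W. voronoi_cell S x)"

text \<open>
  The approximation of a body can be empty or unbounded, so the Hausdorff distance is
  extended-valued; a nonempty set has distance \<open>\<infinity>\<close> from the empty set.
\<close>

definition hausdorff_distance :: "'a::metric_space set \<Rightarrow> 'a set \<Rightarrow> ennreal" where
  "hausdorff_distance A B =
     max (SUP a\<in>A. INF b\<in>B. ennreal (dist a b)) (SUP b\<in>B. INF a\<in>A. ennreal (dist a b))"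

definition alpha1 :: "nat \<Rightarrow> real" where
  "alpha1 d = 1 / fact d *
     (sqrt pi * Gamma (real d / 2 + 1) / Gamma ((real d + 1) / 2)) ^ (d - 1)"

definition kappa :: "'a::euclidean_space itself \<Rightarrow> real" where
  "kappa _ = measure lborel (cball (0::'a) 1)"

definition c_const :: "'a::euclidean_space itself \<Rightarrow> real \<Rightarrow> real" where
  "c_const T \<alpha> = inverse (kappa T) + 2 ^ DIM('a) * inverse (kappa T) * inverse \<alpha>"

end

theory Submission
  imports Defs "HOL-Real_Asymp.Real_Asymp"
begin

text \<open>
  Write \<open>L = ln (\<alpha>\<^sub>1 \<gamma> (ln \<gamma>)\<^bsup>d - 1\<^esup>)\<close> and let \<open>r\<close> be the radius in the theorem, so that
  \<open>\<gamma> \<kappa>\<^sub>d r\<^bsup>d\<^esup> = (1 + 2\<^bsup>d\<^esup> / \<alpha>) L\<close>. The deterministic core is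
  \<open>voronoi_approximation_hausdorff_le\<close>: the Hausdorff distance is at most \<open>r\<close> as soon as every
  ball of radius \<open>r\<close> centred in \<open>W\<close> contains a nucleus lying in \<open>W\<close>, and every open ball of
  radius \<open>r\<close> centred within distance \<open>r\<close> of \<open>W\<close> contains some nucleus. The first condition
  brings the approximation close to each point of \<open>W\<close>, because nuclei belong to their cells.
  The second keeps the cells of nuclei in \<open>W\<close> within distance \<open>r\<close> of their nuclei: a point of
  the cell farther away would give, on the segment to the nucleus, the centre of an empty ball
  of radius \<open>r\<close>.

  Both conditions follow if finitely many balls of radius \<open>r / 2\<close>, with centres in an
  \<open>r / 2\<close>-net, are not void (\<open>hausdorff_probability_ge\<close>). A volume comparison shows that
  \<open>O(r\<^bsup>-d\<^esup>) = O(\<gamma> / L)\<close> centres suffice. Such a ball has \<open>\<gamma> \<kappa>\<^sub>d (r / 2)\<^bsup>d\<^esup> = (2\<^bsup>-d\<^esup> + 1 / \<alpha>) L\<close>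
  expected points, and at least \<open>(\<alpha> 2\<^bsup>-d\<^esup> + 1) L\<close> expected points in \<open>W\<close> if centred in \<open>W\<close>.
  As \<open>\<alpha> \<le> 1\<close>, both numbers are at least \<open>L\<close>, and the failure probability is
  \<open>O(\<gamma> / L \<cdot> exp (- L)) = O(1 / L)\<close>, which tends to 0 (\<open>log_intensity_asymptotics\<close>).

  The probability in the theorem is that of an event only if the set of outcomes is measurable,
  and the process is known only through its counting variables. This is settled by
  \<open>hausdorff_distance_le_event\<close>: the Hausdorff condition is a countable combination of
  conditions that the approximation meets a given open set, and each of those is a countable
  combination of void events (\<open>voronoi_approximation_hits_open_iff\<close>).
\<close>

section \<open>Nets in bounded sets\<close>

text \<open>
  The balls of radius \<open>\<delta> / 2\<close> around the points of a \<open>\<delta>\<close>-separated set are disjoint and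
  contained in a slightly larger ball; their volumes bound their number.
\<close>

lemma separated_card_le:
  fixes Z :: "'a::euclidean_space set"
  assumes fin: "finite Z" and sub: "Z \<subseteq> cball 0 R" and "0 < R" and \<delta>: "0 < \<delta>" "\<delta> \<le> 1"
    and sep: "\<And>x y. x \<in> Z \<Longrightarrow> y \<in> Z \<Longrightarrow> x \<noteq> y \<Longrightarrow> \<delta> \<le> dist x y"
  shows "real (card Z) \<le> (2 * (R + 1) / \<delta>) ^ DIM('a)"
proof -
  let ?u = "unit_ball_vol (real DIM('a))"
  have u: "0 < ?u" by simp
  have disj: "disjoint_family_on (\<lambda>z. ball z (\<delta> / 2)) Z"
    unfolding disjoint_family_on_def
  proof (intro ballI impI)
    fix x y assume "x \<in> Z" "y \<in> Z" "x \<noteq> y"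
    then have "\<delta> \<le> dist x y" by (rule sep)
    then show "ball x (\<delta> / 2) \<inter> ball y (\<delta> / 2) = {}"
      by (intro disjoint_ballI) simp
  qed
  have "real (card Z) * (?u * (\<delta> / 2) ^ DIM('a)) = (\<Sum>z\<in>Z. measure lborel (ball z (\<delta> / 2)))"
    using \<delta> by (simp add: content_ball)
  also have "\<dots> = measure lborel (\<Union>z\<in>Z. ball z (\<delta> / 2))"
    using fin disj by (intro measure_finite_Union[symmetric]) (auto simp: emeasure_bounded_finite[OF bounded_ball, THEN less_imp_neq, unfolded infinity_ennreal_def])
  also have "\<dots> \<le> measure lborel (cball (0::'a) (R + 1))"
  proof (rule measure_mono_fmeasurable)
    show "(\<Union>z\<in>Z. ball z (\<delta> / 2)) \<subseteq> cball 0 (R + 1)"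
    proof
      fix y assume "y \<in> (\<Union>z\<in>Z. ball z (\<delta> / 2))"
      then obtain z where z: "z \<in> Z" "dist z y < \<delta> / 2" by auto
      with sub have "dist 0 z \<le> R" by auto
      with z \<delta> show "y \<in> cball 0 (R + 1)"
        using dist_triangle[of 0 y z] by simp
    qed
  qed (auto intro!: fmeasurableI emeasure_bounded_finite borel_open)
  also have "\<dots> = ?u * (R + 1) ^ DIM('a)"
    using \<open>0 < R\<close> by (simp add: content_cball)
  finally have "?u * (real (card Z) * (\<delta> / 2) ^ DIM('a)) \<le> ?u * (R + 1) ^ DIM('a)"
    by (simp only: mult.left_commute)
  then have "real (card Z) * (\<delta> / 2) ^ DIM('a) \<le> (R + 1) ^ DIM('a)"
    using u by (simp only: mult_le_cancel_left_pos)
  then have "real (card Z) \<le> (R + 1) ^ DIM('a) / (\<delta> / 2) ^ DIM('a)"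
    using \<delta> by (simp add: pos_le_divide_eq)
  also have "\<dots> = (2 * (R + 1) / \<delta>) ^ DIM('a)"
    unfolding power_divide[symmetric] by (simp add: mult.commute)
  finally show ?thesis .
qed

text \<open>A separated set of maximal cardinality is a net.\<close>

lemma bounded_net:
  fixes S :: "'a::euclidean_space set"
  assumes sub: "S \<subseteq> cball 0 R" and "0 < R" and \<delta>: "0 < \<delta>" "\<delta> \<le> 1"
  obtains Z where "finite Z" "Z \<subseteq> S" "real (card Z) \<le> (2 * (R + 1) / \<delta>) ^ DIM('a)"
    "\<And>y. y \<in> S \<Longrightarrow> \<exists>z\<in>Z. dist z y < \<delta>"
proof -
  define P where "P Z \<longleftrightarrow> finite Z \<and> Z \<subseteq> S \<and> (\<forall>x\<in>Z. \<forall>y\<in>Z. x \<noteq> y \<longrightarrow> \<delta> \<le> dist x y)" for Z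
  have bound: "real (card Z) \<le> (2 * (R + 1) / \<delta>) ^ DIM('a)" if "P Z" for Z
    using that sub assms by (intro separated_card_le) (auto simp: P_def)
  have "P {}" by (simp add: P_def)
  moreover have "card Z < Suc (nat \<lceil>(2 * (R + 1) / \<delta>) ^ DIM('a)\<rceil>)" if "P Z" for Z
    using bound[OF that] by linarith
  ultimately obtain Z where Z: "P Z" "\<And>Y. P Y \<Longrightarrow> card Y \<le> card Z"
    using ex_has_greatest_nat[of P "{}" card] by blast
  show thesis
  proof (rule that)
    show "finite Z" "Z \<subseteq> S" using Z(1) by (auto simp: P_def)
    show "real (card Z) \<le> (2 * (R + 1) / \<delta>) ^ DIM('a)" using bound Z(1) .
    fix y assume y: "y \<in> S"
    show "\<exists>z\<in>Z. dist z y < \<delta>"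
    proof (rule ccontr)
      assume "\<not> ?thesis"
      then have far: "\<delta> \<le> dist z y" if "z \<in> Z" for z using that by force
      then have "y \<notin> Z" using \<delta> by force
      moreover have "P (insert y Z)"
        using Z(1) y far by (auto simp: P_def dist_commute)
      ultimately show False
        using Z(2)[of "insert y Z"] Z(1) by (simp add: P_def)
    qed
  qed
qed

section \<open>Open sets met by the Voronoi approximation\<close>

text \<open>
  Moving from a point of a cell towards the nucleus makes all distance comparisons strict: the
  difference of squared distances to \<open>x'\<close> and \<open>x\<close> is affine in the point, nonnegative at \<open>v\<close>
  and positive at \<open>x\<close>.
\<close>

lemma voronoi_interior_shrink:
  fixes v x :: "'a::euclidean_space"
  assumes v: "v \<in> voronoi_cell S x" and t: "0 < t" "t \<le> 1" and x': "x' \<in> S" "x' \<noteq> x"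
  shows "dist (v + t *\<^sub>R (x - v)) x < dist (v + t *\<^sub>R (x - v)) x'"
proof -
  define f where "f y = (norm (y - x'))\<^sup>2 - (norm (y - x))\<^sup>2" for y
  have "f (v + t *\<^sub>R (x - v)) = (1 - t) * f v + t * f x"
    unfolding f_def power2_norm_eq_inner by (simp add: inner_simps inner_commute algebra_simps)
  moreover have "0 \<le> f v"
    using v x' by (auto simp: f_def voronoi_cell_def power_mono)
  moreover have "0 < f x" using x' by (simp add: f_def)
  ultimately have "0 < f (v + t *\<^sub>R (x - v))"
    using t by (simp add: add_nonneg_pos)
  then show ?thesis
    unfolding f_def dist_norm by (simp add: power2_less_imp_less)
qed

lemma locally_finite_gap:
  fixes y :: "'a::metric_space"
  assumes lf: "locally_finite_set S" and far: "\<And>x'. x' \<in> S \<Longrightarrow> \<rho> < dist y x'"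
  obtains \<epsilon> where "0 < \<epsilon>" "\<And>x'. x' \<in> S \<Longrightarrow> \<rho> + \<epsilon> \<le> dist y x'"
proof -
  let ?F = "S \<inter> cball y (\<rho> + 1)"
  have fin: "finite ?F" using lf by (simp add: locally_finite_set_def)
  define \<epsilon> where "\<epsilon> = Min (insert 1 ((\<lambda>x. dist y x - \<rho>) ` ?F))"
  show thesis
  proof (rule that)
    show "0 < \<epsilon>" unfolding \<epsilon>_def using fin far by (subst Min_gr_iff) auto
    fix x' assume x': "x' \<in> S"
    show "\<rho> + \<epsilon> \<le> dist y x'"
    proof (cases "x' \<in> ?F")
      case True
      then have "\<epsilon> \<le> dist y x' - \<rho>" unfolding \<epsilon>_def using fin by (intro Min_le) auto
      then show ?thesis by simp
    next
      case False
      have "\<epsilon> \<le> 1" unfolding \<epsilon>_def using fin by (intro Min_le) auto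
      with False x' show ?thesis by auto
    qed
  qed
qed

text \<open>
  If a cell with nucleus in \<open>W\<close> meets \<open>U\<close>, then after a small move towards the nucleus that
  nucleus is strictly the nearest one, and this persists at a nearby point of the dense set
  \<open>D\<close>. Some ball around that point with rational radius then contains no other nucleus.
\<close>

lemma voronoi_approximation_hits_open_iff:
  fixes S W U D :: "'a::euclidean_space set"
  assumes lf: "locally_finite_set S" and U: "open U"
    and dense: "\<And>G. open G \<Longrightarrow> G \<noteq> {} \<Longrightarrow> \<exists>q\<in>D. q \<in> G"
  shows "voronoi_approximation S W \<inter> U \<noteq> {} \<longleftrightarrow>
    (\<exists>q\<in>D \<inter> U. \<exists>s\<in>\<rat>. S \<inter> (W \<inter> cball q s) \<noteq> {} \<and> S \<inter> (cball q s - W) = {})"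
proof
  assume "voronoi_approximation S W \<inter> U \<noteq> {}"
  then obtain v x where v: "v \<in> U" and x: "x \<in> S" "x \<in> W" and cell: "v \<in> voronoi_cell S x"
    by (auto simp: voronoi_approximation_def)
  obtain e where e: "0 < e" "ball v e \<subseteq> U" using U v open_contains_ball by blast
  \<comment> \<open>This parameter satisfies \<open>t \<le> 1\<close> and \<open>t * dist v x < e\<close>, also when \<open>v = x\<close>.\<close>
  define t where "t = e / (e + dist v x)"
  have t: "0 < t" "t \<le> 1" using e by (auto simp: t_def divide_simps add_pos_nonneg)
  define y where "y = v + t *\<^sub>R (x - v)"
  have "dist v y = t * dist v x"
    using t by (simp add: y_def dist_norm norm_minus_commute)
  also have "\<dots> < e"
  proof -
    have "0 < e + dist v x" using e by (simp add: add_pos_nonneg)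
    then show ?thesis using e by (simp add: t_def divide_simps algebra_simps)
  qed
  finally have yU: "y \<in> U" using e by auto
  have lf': "locally_finite_set (S - {x})"
    using lf by (auto simp: locally_finite_set_def intro: finite_subset[rotated])
  have "dist y x < dist y x'" if "x' \<in> S - {x}" for x'
    unfolding y_def using that by (intro voronoi_interior_shrink[OF cell t]) auto
  then obtain \<epsilon> where \<epsilon>: "0 < \<epsilon>" "\<And>x'. x' \<in> S - {x} \<Longrightarrow> dist y x + \<epsilon> \<le> dist y x'"
    using locally_finite_gap[OF lf'] by blast
  obtain q where q: "q \<in> D" "q \<in> U" "dist y q < \<epsilon> / 4"
    using dense[of "U \<inter> ball y (\<epsilon> / 4)"] U yU \<epsilon>(1)
    by (metis Int_iff centre_in_ball divide_pos_pos empty_iff mem_ball open_Int open_ball zero_less_numeral)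
  obtain s where s: "s \<in> \<rat>" "dist y x + \<epsilon> / 4 < s" "s < dist y x + 3 * \<epsilon> / 4"
    using Rats_dense_in_real[of "dist y x + \<epsilon> / 4" "dist y x + 3 * \<epsilon> / 4"] \<epsilon>(1) by auto
  have "x \<in> cball q s"
    using dist_triangle[of q x y] q s by (simp add: dist_commute)
  moreover have "x' \<notin> cball q s" if "x' \<in> S - {x}" for x'
    using dist_triangle[of y x' q] \<epsilon>(2)[OF that] q s by simp
  ultimately show "\<exists>q\<in>D \<inter> U. \<exists>s\<in>\<rat>. S \<inter> (W \<inter> cball q s) \<noteq> {} \<and> S \<inter> (cball q s - W) = {}"
    using q s x by (intro bexI[of _ q] bexI[of _ s]) force+
next
  assume "\<exists>q\<in>D \<inter> U. \<exists>s\<in>\<rat>. S \<inter> (W \<inter> cball q s) \<noteq> {} \<and> S \<inter> (cball q s - W) = {}"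
  then obtain q s where q: "q \<in> U" and ne: "S \<inter> (W \<inter> cball q s) \<noteq> {}"
    and out: "S \<inter> (cball q s - W) = {}" by auto
  let ?F = "S \<inter> cball q s"
  have fin: "finite ?F" using lf by (simp add: locally_finite_set_def)
  obtain x where x: "x \<in> ?F" "\<And>x'. x' \<in> ?F \<Longrightarrow> dist q x \<le> dist q x'"
  proof (rule that)
    have "?F \<noteq> {}" using ne by auto
    then show "arg_min_on (dist q) ?F \<in> ?F"
      and "\<And>x'. x' \<in> ?F \<Longrightarrow> dist q (arg_min_on (dist q) ?F) \<le> dist q x'"
      using fin by (rule arg_min_if_finite(1)[rotated], intro arg_min_least)
  qed
  have "x \<in> W" using x out by auto
  moreover have "dist q x \<le> dist q x'" if "x' \<in> S" for x'
    using x that by (cases "x' \<in> ?F") auto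
  then have "q \<in> voronoi_cell S x" by (simp add: voronoi_cell_def dist_norm)
  ultimately show "voronoi_approximation S W \<inter> U \<noteq> {}"
    using x q by (auto simp: voronoi_approximation_def)
qed

section \<open>Hausdorff distance to the approximation\<close>

text \<open>
  Only open sets occur on the right: balls of radius slightly above \<open>r\<close> with centres in a
  countable dense subset of \<open>A\<close>, and the set of points farther than \<open>r\<close> from \<open>A\<close>. No
  assumption on \<open>B\<close> is needed; for empty \<open>B\<close> both sides are false.
\<close>

lemma hausdorff_distance_le_iff:
  fixes A B W0 :: "'a::euclidean_space set"
  assumes A: "A \<noteq> {}" and "0 < r" and W0: "W0 \<subseteq> A" "A \<subseteq> closure W0"
  shows "hausdorff_distance A B \<le> ennreal r \<longleftrightarrow>
    (\<forall>w\<in>W0. \<forall>n::nat. B \<inter> ball w (r + inverse (Suc n)) \<noteq> {}) \<and> B \<inter> {y. r < infdist y A} = {}"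
proof -
  have 1: "(INF b\<in>B. ennreal (dist a b)) \<le> ennreal r \<longleftrightarrow> (\<forall>e>0. B \<inter> ball a (r + e) \<noteq> {})"
    if "0 < r" for a :: 'a and B :: "'a set" and r :: real
  proof
    assume le: "(INF b\<in>B. ennreal (dist a b)) \<le> ennreal r"
    show "\<forall>e>0. B \<inter> ball a (r + e) \<noteq> {}"
    proof (intro allI impI)
      fix e :: real assume "0 < e"
      then have "(INF b\<in>B. ennreal (dist a b)) < ennreal (r + e)"
        using le \<open>0 < r\<close> by (simp add: order_le_less_trans ennreal_lessI)
      then obtain b where "b \<in> B" "ennreal (dist a b) < ennreal (r + e)"
        by (auto simp: INF_less_iff)
      then show "B \<inter> ball a (r + e) \<noteq> {}"
        by (auto simp: ennreal_less_iff)
    qed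
  next
    assume h: "\<forall>e>0. B \<inter> ball a (r + e) \<noteq> {}"
    show "(INF b\<in>B. ennreal (dist a b)) \<le> ennreal r"
    proof (rule ennreal_le_epsilon)
      fix e :: real assume "0 < e"
      then obtain b where "b \<in> B" "dist a b < r + e" using h by fastforce
      then have "(INF b\<in>B. ennreal (dist a b)) \<le> ennreal (r + e)"
        by (intro INF_lower2[of b]) (auto intro: ennreal_leI)
      then show "(INF b\<in>B. ennreal (dist a b)) \<le> ennreal r + ennreal e"
        using \<open>0 < r\<close> \<open>0 < e\<close> by (simp add: ennreal_plus)
    qed
  qed
  have 2: "(\<forall>a\<in>A. \<forall>e>0. B \<inter> ball a (r + e) \<noteq> {}) \<longleftrightarrow>
      (\<forall>w\<in>W0. \<forall>n::nat. B \<inter> ball w (r + inverse (Suc n)) \<noteq> {})"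
  proof
    assume h: "\<forall>w\<in>W0. \<forall>n::nat. B \<inter> ball w (r + inverse (Suc n)) \<noteq> {}"
    show "\<forall>a\<in>A. \<forall>e>0. B \<inter> ball a (r + e) \<noteq> {}"
    proof (intro ballI allI impI)
      fix a and e :: real assume "a \<in> A" "0 < e"
      then obtain w where w: "w \<in> W0" "dist w a < e / 2"
        using W0 closure_approachable[of a W0] by (meson half_gt_zero subsetD)
      obtain n where n: "inverse (real (Suc n)) < e / 2"
        using reals_Archimedean[of "e / 2"] \<open>0 < e\<close> by auto
      obtain b where "b \<in> B" "dist w b < r + inverse (Suc n)" using h w by fastforce
      then have "dist a b < r + e"
        using dist_triangle[of a b w] w n by (simp add: dist_commute)
      then show "B \<inter> ball a (r + e) \<noteq> {}" using \<open>b \<in> B\<close> by auto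
    qed
  next
    assume h: "\<forall>a\<in>A. \<forall>e>0. B \<inter> ball a (r + e) \<noteq> {}"
    show "\<forall>w\<in>W0. \<forall>n::nat. B \<inter> ball w (r + inverse (Suc n)) \<noteq> {}"
    proof (intro ballI allI)
      fix w and n :: nat assume "w \<in> W0"
      then have "w \<in> A" using W0(1) by blast
      moreover have "0 < inverse (real (Suc n))" by simp
      ultimately show "B \<inter> ball w (r + inverse (Suc n)) \<noteq> {}" using h by blast
    qed
  qed
  have 3: "(\<forall>e>0. A \<inter> ball b (r + e) \<noteq> {}) \<longleftrightarrow> infdist b A \<le> r" for b
  proof
    assume h: "\<forall>e>0. A \<inter> ball b (r + e) \<noteq> {}"
    show "infdist b A \<le> r"
    proof (rule field_le_epsilon)
      fix e :: real assume "0 < e"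
      then obtain a where "a \<in> A" "dist b a < r + e" using h by fastforce
      then show "infdist b A \<le> r + e" by (intro infdist_le2[of a]) simp_all
    qed
  next
    assume le: "infdist b A \<le> r"
    show "\<forall>e>0. A \<inter> ball b (r + e) \<noteq> {}"
    proof (intro allI impI)
      fix e :: real assume "0 < e"
      then have "(INF a\<in>A. dist b a) < r + e" using le A by (simp add: infdist_notempty)
      then obtain a where "a \<in> A" "dist b a < r + e"
        using cInf_lessD[of "dist b ` A"] A by auto
      then show "A \<inter> ball b (r + e) \<noteq> {}" by auto
    qed
  qed
  have "hausdorff_distance A B \<le> ennreal r \<longleftrightarrow>
      (\<forall>a\<in>A. (INF b\<in>B. ennreal (dist a b)) \<le> ennreal r) \<and>
      (\<forall>b\<in>B. (INF a\<in>A. ennreal (dist b a)) \<le> ennreal r)"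
    by (simp add: hausdorff_distance_def SUP_le_iff dist_commute)
  also have "\<dots> \<longleftrightarrow> (\<forall>w\<in>W0. \<forall>n::nat. B \<inter> ball w (r + inverse (Suc n)) \<noteq> {}) \<and>
      (\<forall>b\<in>B. infdist b A \<le> r)"
    by (simp only: 1[OF \<open>0 < r\<close>] 2 3)
  finally show ?thesis by (auto simp: not_less)
qed

text \<open>
  A cell point \<open>v\<close> is close to \<open>W\<close> because it is close to its nucleus; otherwise the point \<open>y\<close>
  at distance \<open>r\<close> from the nucleus \<open>x\<close> on the segment to \<open>v\<close> has a nucleus nearer than \<open>x\<close>,
  which is then also nearer to \<open>v\<close>.
\<close>

lemma voronoi_approximation_hausdorff_le:
  fixes S W :: "'a::euclidean_space set"
  assumes "0 < r"
    and inside: "\<And>w. w \<in> W \<Longrightarrow> S \<inter> (W \<inter> cball w r) \<noteq> {}"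
    and near: "\<And>w y. w \<in> W \<Longrightarrow> dist w y \<le> r \<Longrightarrow> S \<inter> ball y r \<noteq> {}"
  shows "hausdorff_distance W (voronoi_approximation S W) \<le> ennreal r"
proof -
  have "(INF v\<in>voronoi_approximation S W. ennreal (dist w v)) \<le> ennreal r" if w: "w \<in> W" for w
  proof -
    obtain x where x: "x \<in> S" "x \<in> W" "dist w x \<le> r" using inside[OF w] by auto
    then have "x \<in> voronoi_approximation S W"
      by (auto simp: voronoi_approximation_def voronoi_cell_def intro!: bexI[of _ x])
    then show ?thesis using x by (intro INF_lower2[of x]) (auto intro: ennreal_leI)
  qed
  moreover have "(INF w\<in>W. ennreal (dist w v)) \<le> ennreal r" if v: "v \<in> voronoi_approximation S W" for v
  proof -
    obtain x where x: "x \<in> S" "x \<in> W" "v \<in> voronoi_cell S x"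
      using v by (auto simp: voronoi_approximation_def)
    have "dist x v \<le> r"
    proof (rule ccontr)
      assume "\<not> dist x v \<le> r"
      then have far: "r < dist x v" by simp
      define t where "t = r / dist x v"
      have t: "0 < t" "t < 1" using far \<open>0 < r\<close> by (auto simp: t_def divide_simps)
      define y where "y = x + t *\<^sub>R (v - x)"
      have "dist x y = t * dist x v"
        using t by (simp add: y_def dist_norm norm_minus_commute)
      then have xy: "dist x y = r" using far \<open>0 < r\<close> by (auto simp: t_def)
      have "v - y = (1 - t) *\<^sub>R (v - x)" by (simp add: y_def algebra_simps)
      then have "dist y v = (1 - t) * dist x v"
        using t by (simp add: dist_norm norm_minus_commute)
      then have yv: "dist y v = dist x v - r"
        using far \<open>0 < r\<close> by (auto simp: t_def left_diff_distrib)
      obtain x' where x': "x' \<in> S" "dist y x' < r" using near[OF x(2), of y] xy by auto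
      then have "x' \<noteq> x" using xy by (auto simp: dist_commute)
      then have "dist v x \<le> dist v x'" using x x' by (simp add: voronoi_cell_def dist_norm)
      moreover have "dist v x' < dist x v"
        using dist_triangle[of v x' y] x' yv by (simp add: dist_commute)
      ultimately show False by (simp add: dist_commute)
    qed
    then show ?thesis using x by (intro INF_lower2[of x]) (auto intro: ennreal_leI)
  qed
  ultimately show ?thesis by (simp add: hausdorff_distance_def SUP_le_iff)
qed

section \<open>Void events and the union bound\<close>

context homogeneous_poisson_process
begin

lemma empty_iff_count_0:
  assumes "\<omega> \<in> space M" "bounded B"
  shows "X \<omega> \<inter> B = {} \<longleftrightarrow> card (X \<omega> \<inter> B) = 0"
  using locally_finite[OF assms(1)] assms(2) by (simp add: locally_finite_set_def)

lemma void_event: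
  assumes "B \<in> sets borel" "bounded B"
  shows "{\<omega> \<in> space M. X \<omega> \<inter> B = {}} \<in> events"
proof -
  have "(\<lambda>\<omega>. card (X \<omega> \<inter> B)) -` {0} \<inter> space M \<in> events"
    using count_random_variable[OF assms] by (rule measurable_sets) simp
  also have "(\<lambda>\<omega>. card (X \<omega> \<inter> B)) -` {0} \<inter> space M = {\<omega> \<in> space M. X \<omega> \<inter> B = {}}"
    using empty_iff_count_0 assms by auto
  finally show ?thesis .
qed

lemma void_probability:
  assumes "B \<in> sets borel" "bounded B"
  shows "prob {\<omega> \<in> space M. X \<omega> \<inter> B = {}} = exp (- (\<gamma> * measure lborel B))"
proof -
  have "{\<omega> \<in> space M. X \<omega> \<inter> B = {}} = {\<omega> \<in> space M. card (X \<omega> \<inter> B) = 0}"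
    using empty_iff_count_0 assms by auto
  then show ?thesis using count_poisson[OF assms, of 0] by simp
qed

lemma voronoi_approximation_hits_open_event:
  assumes W: "W \<in> sets borel" and U: "open U"
  shows "{\<omega> \<in> space M. voronoi_approximation (X \<omega>) W \<inter> U \<noteq> {}} \<in> events"
proof -
  obtain D :: "'a set" where D: "countable D" "\<And>G. open G \<Longrightarrow> G \<noteq> {} \<Longrightarrow> \<exists>q\<in>D. q \<in> G"
    by (rule countable_dense_setE) blast
  have meas: "{\<omega> \<in> space M. X \<omega> \<inter> (W \<inter> cball q s) \<noteq> {} \<and> X \<omega> \<inter> (cball q s - W) = {}} \<in> events"
    for q s
  proof -
    have "{\<omega> \<in> space M. X \<omega> \<inter> (W \<inter> cball q s) = {}} \<in> events"
         "{\<omega> \<in> space M. X \<omega> \<inter> (cball q s - W) = {}} \<in> events"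
      using W by (auto intro!: void_event bounded_subset[OF bounded_cball])
    then show ?thesis by measurable
  qed
  have "{\<omega> \<in> space M. \<exists>q\<in>D \<inter> U. \<exists>s\<in>\<rat>. X \<omega> \<inter> (W \<inter> cball q s) \<noteq> {} \<and> X \<omega> \<inter> (cball q s - W) = {}}
      \<in> events"
    using D(1) countable_rat by (intro sets.sets_Collect_countable_Ex' meas) auto
  also have "{\<omega> \<in> space M. \<exists>q\<in>D \<inter> U. \<exists>s\<in>\<rat>. X \<omega> \<inter> (W \<inter> cball q s) \<noteq> {} \<and> X \<omega> \<inter> (cball q s - W) = {}}
      = {\<omega> \<in> space M. voronoi_approximation (X \<omega>) W \<inter> U \<noteq> {}}"
    by (intro Collect_cong conj_cong refl
        voronoi_approximation_hits_open_iff[OF locally_finite U D(2), symmetric])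
  finally show ?thesis .
qed

lemma hausdorff_distance_le_event:
  assumes W: "W \<in> sets borel" "W \<noteq> {}" and r: "0 < r"
  shows "{\<omega> \<in> space M. hausdorff_distance W (voronoi_approximation (X \<omega>) W) \<le> ennreal r} \<in> events"
proof -
  obtain W0 where W0: "countable W0" "W0 \<subseteq> W" "W \<subseteq> closure W0"
    using separable by blast
  have "open {y. r < infdist y W}"
    by (intro open_Collect_less continuous_intros)
  note hit = voronoi_approximation_hits_open_event[OF W(1) this]
    voronoi_approximation_hits_open_event[OF W(1) open_ball]
  have "{\<omega> \<in> space M. (\<forall>w\<in>W0. \<forall>n::nat. voronoi_approximation (X \<omega>) W \<inter> ball w (r + inverse (Suc n)) \<noteq> {})
      \<and> \<not> (voronoi_approximation (X \<omega>) W \<inter> {y. r < infdist y W} \<noteq> {})} \<in> events"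
    by (intro sets.sets_Collect_conj sets.sets_Collect_neg sets.sets_Collect_countable_All'
        sets.sets_Collect_countable_All hit W0(1))
  then show ?thesis
    by (simp only: hausdorff_distance_le_iff[OF W(2) r W0(2,3)] not_not)
qed

text \<open>
  Here \<open>p\<close> is a lower bound for the expected number of points in each test ball of radius
  \<open>r / 2\<close>; each of the two nets has at most \<open>(4 * (R + 2) / r) ^ DIM('a)\<close> points.
\<close>

lemma hausdorff_probability_ge:
  assumes W: "W \<in> sets borel" "W \<noteq> {}" "W \<subseteq> cball 0 R" and "0 < R"
    and r: "0 < r" "r \<le> 1"
    and inner: "\<And>y. y \<in> W \<Longrightarrow> p \<le> \<gamma> * measure lborel (W \<inter> cball y (r / 2))"
    and outer: "\<And>y::'a. p \<le> \<gamma> * measure lborel (ball y (r / 2))"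
  shows "prob {\<omega> \<in> space M. hausdorff_distance W (voronoi_approximation (X \<omega>) W) \<le> ennreal r}
    \<ge> 1 - 2 * (4 * (R + 2) / r) ^ DIM('a) * exp (- p)"
proof -
  let ?K = "(4 * (R + 2) / r) ^ DIM('a)"
  let ?E = "{\<omega> \<in> space M. hausdorff_distance W (voronoi_approximation (X \<omega>) W) \<le> ennreal r}"
  define void where "void B = {\<omega> \<in> space M. X \<omega> \<inter> B = {}}" for B
  have sub: "{y. \<exists>w\<in>W. dist w y \<le> r} \<subseteq> cball 0 (R + 1)"
  proof
    fix y assume "y \<in> {y. \<exists>w\<in>W. dist w y \<le> r}"
    then obtain w where "w \<in> W" "dist w y \<le> r" by auto
    with W(3) r show "y \<in> cball 0 (R + 1)" using dist_triangle[of 0 y w] by fastforce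
  qed
  have r2: "0 < r / 2" "r / 2 \<le> 1" and R1: "0 < R + 1" using r \<open>0 < R\<close> by auto
  obtain Z1 where Z1: "finite Z1" "Z1 \<subseteq> W" "real (card Z1) \<le> (2 * (R + 1) / (r / 2)) ^ DIM('a)"
      "\<And>y. y \<in> W \<Longrightarrow> \<exists>z\<in>Z1. dist z y < r / 2"
    by (rule bounded_net[OF W(3) \<open>0 < R\<close> r2]) (rule that)
  obtain Z2 where Z2: "finite Z2" "Z2 \<subseteq> {y. \<exists>w\<in>W. dist w y \<le> r}"
      "real (card Z2) \<le> (2 * (R + 1 + 1) / (r / 2)) ^ DIM('a)"
      "\<And>y. y \<in> {y. \<exists>w\<in>W. dist w y \<le> r} \<Longrightarrow> \<exists>z\<in>Z2. dist z y < r / 2"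
    by (rule bounded_net[OF sub R1 r2]) (rule that)
  have "(2 * (R + 1) / (r / 2)) ^ DIM('a) \<le> ?K"
    using \<open>0 < R\<close> r by (intro power_mono) (auto simp: divide_simps)
  with Z1(3) have K1: "real (card Z1) \<le> ?K" by simp
  have K2: "real (card Z2) \<le> ?K"
    using Z2(3) by (simp add: algebra_simps)
  have bdd1: "W \<inter> cball z (r / 2) \<in> sets borel" "bounded (W \<inter> cball z (r / 2))" for z
    using W(1) by (auto intro: bounded_subset[OF bounded_cball])
  have bdd2: "ball z (r / 2) \<in> sets borel" "bounded (ball z (r / 2))" for z :: 'a
    by auto
  have cover: "space M - ?E \<subseteq> (\<Union>z\<in>Z1. void (W \<inter> cball z (r / 2))) \<union> (\<Union>z\<in>Z2. void (ball z (r / 2)))"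
  proof
    fix \<omega> assume \<omega>: "\<omega> \<in> space M - ?E"
    show "\<omega> \<in> (\<Union>z\<in>Z1. void (W \<inter> cball z (r / 2))) \<union> (\<Union>z\<in>Z2. void (ball z (r / 2)))"
    proof (rule ccontr)
      assume neg: "\<not> ?thesis"
      then have hit1: "X \<omega> \<inter> (W \<inter> cball z (r / 2)) \<noteq> {}" if "z \<in> Z1" for z
        using \<omega> that by (auto simp: void_def)
      from neg have hit2: "X \<omega> \<inter> ball z (r / 2) \<noteq> {}" if "z \<in> Z2" for z
        using \<omega> that by (auto simp: void_def)
      have "hausdorff_distance W (voronoi_approximation (X \<omega>) W) \<le> ennreal r"
      proof (rule voronoi_approximation_hausdorff_le[OF r(1)])
        fix w assume "w \<in> W"
        then obtain z where z: "z \<in> Z1" "dist z w < r / 2" using Z1(4) by blast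
        have "cball z (r / 2) \<subseteq> cball w r"
        proof
          fix x assume "x \<in> cball z (r / 2)"
          with z show "x \<in> cball w r" using dist_triangle[of w x z] by (simp add: dist_commute)
        qed
        then show "X \<omega> \<inter> (W \<inter> cball w r) \<noteq> {}" using hit1[OF z(1)] by blast
      next
        fix w y assume "w \<in> W" "dist w y \<le> r"
        then obtain z where z: "z \<in> Z2" "dist z y < r / 2" using Z2(4)[of y] by blast
        have "ball z (r / 2) \<subseteq> ball y r"
        proof
          fix x assume "x \<in> ball z (r / 2)"
          with z show "x \<in> ball y r" using dist_triangle[of y x z] by (simp add: dist_commute)
        qed
        then show "X \<omega> \<inter> ball y r \<noteq> {}" using hit2[OF z(1)] by blast
      qed
      then show False using \<omega> by simp
    qed
  qed
  have void_events: "void (W \<inter> cball z (r / 2)) \<in> events" "void (ball z (r / 2)) \<in> events" for z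
    unfolding void_def using bdd1 bdd2 by (auto intro: void_event)
  have E: "?E \<in> events" by (rule hausdorff_distance_le_event[OF W(1,2) r(1)])
  have un1: "prob (\<Union>z\<in>Z1. void (W \<inter> cball z (r / 2))) \<le> ?K * exp (- p)"
  proof -
    have "prob (\<Union>z\<in>Z1. void (W \<inter> cball z (r / 2))) \<le> (\<Sum>z\<in>Z1. prob (void (W \<inter> cball z (r / 2))))"
      using Z1(1) void_events by (intro finite_measure_subadditive_finite) auto
    also have "\<dots> \<le> (\<Sum>z\<in>Z1. exp (- p))"
      using Z1(2) inner by (intro sum_mono) (auto simp: void_def void_probability[OF bdd1])
    also have "\<dots> \<le> ?K * exp (- p)" using K1 by (simp add: mult_right_mono)
    finally show ?thesis .
  qed
  have un2: "prob (\<Union>z\<in>Z2. void (ball z (r / 2))) \<le> ?K * exp (- p)"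
  proof -
    have "prob (\<Union>z\<in>Z2. void (ball z (r / 2))) \<le> (\<Sum>z\<in>Z2. prob (void (ball z (r / 2))))"
      using Z2(1) void_events by (intro finite_measure_subadditive_finite) auto
    also have "\<dots> \<le> (\<Sum>z\<in>Z2. exp (- p))"
      using outer by (intro sum_mono) (auto simp: void_def void_probability[OF bdd2])
    also have "\<dots> \<le> ?K * exp (- p)" using K2 by (simp add: mult_right_mono)
    finally show ?thesis .
  qed
  have "1 - prob ?E = prob (space M - ?E)" using E by (simp add: prob_compl)
  also have "\<dots> \<le> prob ((\<Union>z\<in>Z1. void (W \<inter> cball z (r / 2))) \<union> (\<Union>z\<in>Z2. void (ball z (r / 2))))"
    by (intro finite_measure_mono cover sets.Un sets.finite_UN Z1(1) Z2(1) void_events)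
  also have "\<dots> \<le> prob (\<Union>z\<in>Z1. void (W \<inter> cball z (r / 2))) + prob (\<Union>z\<in>Z2. void (ball z (r / 2)))"
    by (intro measure_Un_le sets.finite_UN Z1(1) Z2(1) void_events)
  also have "\<dots> \<le> 2 * ?K * exp (- p)" using un1 un2 by linarith
  finally show ?thesis by linarith
qed

end

section \<open>Asymptotics in the intensity\<close>

lemma alpha1_pos: "0 < alpha1 d"
  unfolding alpha1_def by (intro mult_pos_pos zero_less_power divide_pos_pos Gamma_real_pos) auto

lemma log_intensity_asymptotics:
  fixes a :: real and k :: nat
  assumes "0 < a"
  defines "L \<equiv> \<lambda>x. ln (a * x * ln x ^ k)"
  shows "filterlim L at_top at_top"
    and "((\<lambda>x. inverse x * L x) \<longlongrightarrow> 0) at_top"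
    and "((\<lambda>x. x / L x * exp (- L x)) \<longlongrightarrow> 0) at_top"
proof -
  \<comment> \<open>Beyond \<open>exp 1\<close> the bound \<open>ln x > 1\<close> holds, so \<open>ln (ln x)\<close> is positive.\<close>
  have ev: "eventually (\<lambda>x. exp (1::real) < x) at_top" by (rule eventually_gt_at_top)
  have x0: "0 < x" if "x > exp 1" for x :: real
    using that exp_gt_zero[of 1] by linarith
  have ln1: "1 < ln x" if "x > exp 1" for x :: real
    using that x0[OF that] ln_less_cancel_iff[of "exp 1" x] by simp
  have L_eq: "L x = ln a + ln x + real k * ln (ln x)" if "x > exp 1" for x
    unfolding L_def using ln1[OF that] x0[OF that] \<open>0 < a\<close>
    by (auto simp: ln_mult ln_realpow)
  have ge: "ln a + ln x \<le> L x" if "x > exp 1" for x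
    using L_eq[OF that] ln1[OF that] by simp
  have "filterlim (\<lambda>x::real. ln a + ln x) at_top at_top"
    by (intro filterlim_tendsto_add_at_top[OF tendsto_const] ln_at_top)
  then show top: "filterlim L at_top at_top"
    by (rule filterlim_at_top_mono) (rule eventually_mono[OF ev ge])
  have 1: "((\<lambda>x::real. inverse x * ln a) \<longlongrightarrow> 0) at_top" by real_asymp
  have 2: "((\<lambda>x::real. inverse x * ln x) \<longlongrightarrow> 0) at_top" by real_asymp
  have 3: "((\<lambda>x::real. inverse x * ln (ln x)) \<longlongrightarrow> 0) at_top" by real_asymp
  have "((\<lambda>x. inverse x * ln a + inverse x * ln x + real k * (inverse x * ln (ln x)))
      \<longlongrightarrow> 0 + 0 + real k * 0) at_top"
    by (intro tendsto_intros 1 2 3)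
  then have "((\<lambda>x. inverse x * ln a + inverse x * ln x + real k * (inverse x * ln (ln x)))
      \<longlongrightarrow> 0) at_top" by simp
  then show "((\<lambda>x. inverse x * L x) \<longlongrightarrow> 0) at_top"
    by (rule Lim_transform_eventually) (use ev in eventually_elim, simp add: L_eq algebra_simps)
  have inv: "((\<lambda>x. inverse a * inverse (L x)) \<longlongrightarrow> 0) at_top"
    using tendsto_mult_right_zero[OF tendsto_inverse_0_at_top[OF top]] .
  show "((\<lambda>x. x / L x * exp (- L x)) \<longlongrightarrow> 0) at_top"
  proof (rule tendsto_sandwich[OF _ _ tendsto_const inv])
    have "eventually (\<lambda>x. 0 < L x) at_top" using top by (simp add: filterlim_at_top_dense)
    then show "eventually (\<lambda>x. 0 \<le> x / L x * exp (- L x)) at_top"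
      using ev by eventually_elim (simp add: x0 less_imp_le)
    show "eventually (\<lambda>x. x / L x * exp (- L x) \<le> inverse a * inverse (L x)) at_top"
      using \<open>eventually (\<lambda>x. 0 < L x) at_top\<close> ev
    proof eventually_elim
      case (elim x)
      have "ln (a * x) \<le> L x" using ge[OF elim(2)] x0[OF elim(2)] \<open>0 < a\<close> by (simp add: ln_mult)
      then have "exp (- L x) \<le> exp (- ln (a * x))" by simp
      also have "\<dots> = inverse (a * x)"
        using x0[OF elim(2)] \<open>0 < a\<close> by (simp add: exp_minus)
      finally have "x / L x * exp (- L x) \<le> x / L x * inverse (a * x)"
        using elim x0[OF elim(2)] by (intro mult_left_mono) auto
      also have "\<dots> = inverse a * inverse (L x)" using x0[OF elim(2)] by (simp add: field_simps)
      finally show ?case .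
    qed
  qed
qed

section \<open>Convergence of the probability\<close>

theorem corollary2:
  fixes M :: "real \<Rightarrow> 'w measure"
    and X :: "real \<Rightarrow> 'w \<Rightarrow> 'a::euclidean_space set"
    and W :: "'a set"
    and \<alpha> :: real
  assumes poisson: "\<And>\<gamma>. 0 < \<gamma> \<Longrightarrow> homogeneous_poisson_process (M \<gamma>) (X \<gamma>) \<gamma>"
    and body: "convex_body W"
    and volume: "measure lborel W = 1"
    and alpha_pos: "0 < \<alpha>"
    and density: "\<forall>\<^sub>F v in at_right 0. \<forall>y\<in>W.
      measure lborel (cball y v \<inter> W) \<ge> \<alpha> * measure lborel (cball y v)"
  shows "((\<lambda>\<gamma>. measure (M \<gamma>) {\<omega> \<in> space (M \<gamma>).
      hausdorff_distance W (voronoi_approximation (X \<gamma> \<omega>) W) \<le>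
        ennreal (root DIM('a) (c_const TYPE('a) \<alpha> * inverse \<gamma> *
          ln (alpha1 DIM('a) * \<gamma> * ln \<gamma> ^ (DIM('a) - 1))))}) \<longlongrightarrow> 1) at_top"
proof -
  define d where "d = DIM('a)"
  define \<kappa> where "\<kappa> = unit_ball_vol (real d)"
  define c where "c = c_const TYPE('a) \<alpha>"
  define L where "L \<gamma> = ln (alpha1 d * \<gamma> * ln \<gamma> ^ (d - 1))" for \<gamma>
  define r where "r \<gamma> = root d (c * inverse \<gamma> * L \<gamma>)" for \<gamma>
  have d: "0 < d" by (simp add: d_def)
  have \<kappa>: "0 < \<kappa>" by (simp add: \<kappa>_def)
  have vol_cball: "measure lborel (cball y v) = \<kappa> * v ^ d"
    and vol_ball: "measure lborel (ball y v) = \<kappa> * v ^ d" if "0 \<le> v" for y :: 'a and v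
    using that by (simp_all add: content_cball content_ball \<kappa>_def d_def)
  have c: "c = (1 + 2 ^ d / \<alpha>) / \<kappa>"
    using vol_cball[of 1 0] by (simp add: c_def c_const_def kappa_def divide_simps) (simp add: field_simps d_def)
  have c_pos: "0 < c" using \<kappa> alpha_pos by (simp add: c add_pos_pos)
  have W: "compact W" "W \<noteq> {}" using body by (auto simp: convex_body_def)
  have W_borel: "W \<in> sets borel" using W(1) by (simp add: borel_compact)
  obtain R where R: "0 < R" "W \<subseteq> cball 0 R"
    using compact_imp_bounded[OF W(1)] by (auto simp: bounded_pos subset_iff)
  \<comment> \<open>A ball cannot have more volume inside \<open>W\<close> than in total.\<close>
  have alpha_le: "\<alpha> \<le> 1"
  proof -
    have "\<forall>\<^sub>F v in at_right 0. 0 < (v::real)" by (rule eventually_at_right_less)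
    with density have "\<forall>\<^sub>F v in at_right (0::real). \<alpha> \<le> 1"
    proof eventually_elim
      case (elim v)
      obtain y where y: "y \<in> W" using W(2) by auto
      have "\<alpha> * measure lborel (cball y v) \<le> measure lborel (cball y v \<inter> W)" using elim y by blast
      also have "\<dots> \<le> measure lborel (cball y v)"
        using W_borel by (intro measure_mono_fmeasurable) (auto intro!: fmeasurableI emeasure_bounded_finite)
      finally show ?case using elim(2) \<kappa> by (simp add: vol_cball)
    qed
    then show ?thesis by simp
  qed
  note asymp = log_intensity_asymptotics[OF alpha1_pos, of d "d - 1", folded L_def]
  have pos: "\<forall>\<^sub>F \<gamma> in at_top. 0 < \<gamma> \<and> 0 < L \<gamma>"
    using asymp(1) eventually_gt_at_top[of 0] by (auto simp: filterlim_at_top_dense eventually_conj_iff)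
  have r_pos: "\<forall>\<^sub>F \<gamma> in at_top. 0 < r \<gamma>"
    using pos by eventually_elim (simp add: r_def d c_pos)
  have "((\<lambda>\<gamma>. c * (inverse \<gamma> * L \<gamma>)) \<longlongrightarrow> c * 0) at_top"
    by (intro tendsto_intros asymp(2))
  then have r_0: "(r \<longlongrightarrow> 0) at_top"
    unfolding r_def using tendsto_real_root[of _ 0 at_top d] by (simp add: mult.assoc)
  have "filterlim (\<lambda>\<gamma>. r \<gamma> / 2) (at_right 0) at_top"
  proof (rule tendsto_imp_filterlim_at_right)
    show "((\<lambda>\<gamma>. r \<gamma> / 2) \<longlongrightarrow> 0) at_top" using tendsto_divide[OF r_0 tendsto_const, of 2] by simp
    show "\<forall>\<^sub>F \<gamma> in at_top. 0 < r \<gamma> / 2" using r_pos by simp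
  qed
  then have dens: "\<forall>\<^sub>F \<gamma> in at_top. \<forall>y\<in>W.
      \<alpha> * measure lborel (cball y (r \<gamma> / 2)) \<le> measure lborel (cball y (r \<gamma> / 2) \<inter> W)"
    using density by (rule eventually_compose_filterlim[rotated])
  have r_le: "\<forall>\<^sub>F \<gamma> in at_top. r \<gamma> \<le> 1"
    using order_tendstoD(2)[OF r_0, of 1] by (auto elim: eventually_mono)
  define prb where "prb \<gamma> = measure (M \<gamma>) {\<omega> \<in> space (M \<gamma>).
      hausdorff_distance W (voronoi_approximation (X \<gamma> \<omega>) W) \<le> ennreal (r \<gamma>)}" for \<gamma>
  define C where "C = 2 * (4 * (R + 2)) ^ d / c"
  have lower: "\<forall>\<^sub>F \<gamma> in at_top. 1 - C * (\<gamma> / L \<gamma> * exp (- L \<gamma>)) \<le> prb \<gamma>"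
    using pos r_pos r_le dens
  proof eventually_elim
    case (elim \<gamma>)
    interpret homogeneous_poisson_process "M \<gamma>" "X \<gamma>" \<gamma> using poisson elim by blast
    have rd: "r \<gamma> ^ d = c * L \<gamma> / \<gamma>"
    proof -
      have "0 \<le> c * inverse \<gamma> * L \<gamma>" using c_pos elim(1) by (intro mult_nonneg_nonneg) auto
      then have "r \<gamma> ^ d = c * inverse \<gamma> * L \<gamma>"
        unfolding r_def by (rule real_root_pow_pos2[OF d])
      then show ?thesis by (simp add: field_simps)
    qed
    have half: "\<gamma> * (\<kappa> * (r \<gamma> / 2) ^ d) = (1 / 2 ^ d + 1 / \<alpha>) * L \<gamma>"
    proof -
      have kc: "\<kappa> * c = 1 + 2 ^ d / \<alpha>" using \<kappa> unfolding c by simp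
      have "\<gamma> * (\<kappa> * (r \<gamma> / 2) ^ d) = \<kappa> * c * (L \<gamma> / 2 ^ d)"
        unfolding power_divide rd using elim(1) by simp
      also have "\<dots> = (1 / 2 ^ d + 1 / \<alpha>) * L \<gamma>"
        unfolding kc by (simp add: field_simps)
      finally show ?thesis .
    qed
    have outer: "L \<gamma> \<le> \<gamma> * measure lborel (ball y (r \<gamma> / 2))" for y :: 'a
    proof -
      have "1 \<le> 1 / \<alpha>" using alpha_pos alpha_le by simp
      moreover have "0 \<le> 1 / (2::real) ^ d" by simp
      ultimately have "1 \<le> 1 / 2 ^ d + 1 / \<alpha>" by linarith
      then have "1 * L \<gamma> \<le> (1 / 2 ^ d + 1 / \<alpha>) * L \<gamma>"
        using elim(1) by (intro mult_right_mono) auto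
      then show ?thesis using half vol_ball[of "r \<gamma> / 2" y] elim(2) by simp
    qed
    have inner: "L \<gamma> \<le> \<gamma> * measure lborel (W \<inter> cball y (r \<gamma> / 2))" if "y \<in> W" for y
    proof -
      have "\<alpha> * (1 / 2 ^ d + 1 / \<alpha>) = \<alpha> / 2 ^ d + 1" using alpha_pos by (simp add: distrib_left)
      then have "1 \<le> \<alpha> * (1 / 2 ^ d + 1 / \<alpha>)" using alpha_pos by simp
      then have "1 * L \<gamma> \<le> \<alpha> * (1 / 2 ^ d + 1 / \<alpha>) * L \<gamma>"
        using elim(1) by (intro mult_right_mono) auto
      then have "L \<gamma> \<le> \<alpha> * ((1 / 2 ^ d + 1 / \<alpha>) * L \<gamma>)" by (simp only: mult.assoc mult_1)
      also have "\<dots> = \<gamma> * (\<alpha> * measure lborel (cball y (r \<gamma> / 2)))"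
        unfolding half[symmetric] vol_cball[OF less_imp_le[OF half_gt_zero[OF elim(2)]]]
        by (rule mult.left_commute)
      also have "\<dots> \<le> \<gamma> * measure lborel (W \<inter> cball y (r \<gamma> / 2))"
      proof (rule mult_left_mono)
        show "\<alpha> * measure lborel (cball y (r \<gamma> / 2)) \<le> measure lborel (W \<inter> cball y (r \<gamma> / 2))"
          using elim(4) that by (simp only: Int_commute)
      qed (use elim(1) in simp)
      finally show ?thesis .
    qed
    have "1 - 2 * (4 * (R + 2) / r \<gamma>) ^ d * exp (- L \<gamma>) \<le> prb \<gamma>"
      unfolding prb_def d_def
      by (intro hausdorff_probability_ge W_borel W(2) R elim(2,3) inner outer)
    also have "2 * (4 * (R + 2) / r \<gamma>) ^ d * exp (- L \<gamma>) = C * (\<gamma> / L \<gamma> * exp (- L \<gamma>))"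
      unfolding C_def power_divide rd by simp
    finally show ?case .
  qed
  have upper: "\<forall>\<^sub>F \<gamma> in at_top. prb \<gamma> \<le> 1"
    using eventually_gt_at_top[of 0]
  proof eventually_elim
    case (elim \<gamma>)
    interpret homogeneous_poisson_process "M \<gamma>" "X \<gamma>" \<gamma> using poisson elim by blast
    show ?case by (simp add: prb_def)
  qed
  have "((\<lambda>\<gamma>. 1 - C * (\<gamma> / L \<gamma> * exp (- L \<gamma>))) \<longlongrightarrow> 1 - C * 0) at_top"
    by (intro tendsto_intros asymp(3))
  then have "(prb \<longlongrightarrow> 1) at_top"
    using tendsto_sandwich[OF lower upper _ tendsto_const] by simp
  then show ?thesis by (simp add: prb_def[abs_def] r_def L_def c_def d_def)
qed

end
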